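(* For $\alpha\in(-2,2)$, the following conditions are equivalent. (a) The function $f_\alpha$ has a unique maximizer in $[0,1/2]$. (b) There is no Littlewood polynomial that has $\alpha$ as its step root.
   Context: For $\alpha\in(-2,2)$, $f_\alpha(t)=\sum_{m=0}^\infty\frac{\alpha^m}{2^m}\phi(2^mt)$, $t\in[0,1]$, where $\phi(t)=\min_{z\in\mathbb Z}|t-z|$. A maximizer of $f_\alpha$ is a point at which the global maximum of $f_\alpha$ over $[0,1]$ is attained. A Littlewood polynomial is a polynomial all of whose coefficients are $-1$ or $+1$. Given $n\in\mathbb N=\{1,2,\dots\}$ and a Littlewood polynomial $P_n(x)=\sum_{m=0}^n\rho_mx^m$ with $\rho_m\in\{-1,+1\}$, write $P_k(x)=\sum_{m=0}^k\rho_mx^m$ for $k\le n$. A number $\alpha\in\mathbb R$ is called a step root of $P_n$ if $P_n(\alpha)=0$ and $\rho_{k+1}P_k(\alpha)\le0$ for $k=0,\dots,n-1$. *)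

theory Defs
  imports "HOL-Analysis.Analysis" "HOL-Computational_Algebra.Polynomial"
begin

definition tent :: "real \<Rightarrow> real" where
  "tent t = (INF z\<in>\<int>. \<bar>t - z\<bar>)"

text \<open>The infimum over the integers is attained, so it is the minimum.\<close>

lemma tent_is_min: "\<exists>z\<in>\<int>. tent t = \<bar>t - z\<bar> \<and> (\<forall>w\<in>\<int>. \<bar>t - z\<bar> \<le> \<bar>t - w\<bar>)"
proof -
  let ?z = "real_of_int (round t)"
  have min: "\<bar>t - ?z\<bar> \<le> \<bar>t - w\<bar>" if "w \<in> \<int>" for w
    using that round_diff_minimal[of t] by (auto elim!: Ints_cases)
  have "tent t = \<bar>t - ?z\<bar>"
    unfolding tent_def
    by (rule cInf_eq_minimum) (use min in auto)
  with min show ?thesis by (intro bexI[of _ ?z]) auto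
qed

definition takagi :: "real \<Rightarrow> real \<Rightarrow> real" where
  "takagi \<alpha> t = (\<Sum>m. \<alpha> ^ m / 2 ^ m * tent (2 ^ m * t))"

text \<open>For the parameters under consideration the series converges, so that its formal
  sum is not a default value.\<close>

lemma takagi_summable:
  assumes "\<alpha> \<in> {-2<..<2}"
  shows "summable (\<lambda>m. \<alpha> ^ m / 2 ^ m * tent (2 ^ m * t))"
proof (rule summable_comparison_test)
  have tent_bound: "\<bar>tent x\<bar> \<le> 1" for x
  proof -
    obtain z where "tent x = \<bar>x - z\<bar>" "\<forall>w\<in>\<int>. \<bar>x - z\<bar> \<le> \<bar>x - w\<bar>"
      using tent_is_min by blast
    moreover have "\<bar>x - of_int \<lfloor>x\<rfloor>\<bar> \<le> 1" by linarith
    ultimately show ?thesis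
      by (metis Ints_of_int abs_idempotent order_trans)
  qed
  show "\<exists>N. \<forall>n\<ge>N. norm (\<alpha> ^ n / 2 ^ n * tent (2 ^ n * t)) \<le> \<bar>\<alpha> / 2\<bar> ^ n"
  proof (intro exI allI impI)
    fix n :: nat
    have "\<bar>\<alpha> / 2\<bar> ^ n * \<bar>tent (2 ^ n * t)\<bar> \<le> \<bar>\<alpha> / 2\<bar> ^ n"
      using tent_bound by (intro mult_left_le) auto
    then show "norm (\<alpha> ^ n / 2 ^ n * tent (2 ^ n * t)) \<le> \<bar>\<alpha> / 2\<bar> ^ n"
      by (simp add: abs_mult power_abs power_divide)
  qed
  show "summable (\<lambda>n. \<bar>\<alpha> / 2\<bar> ^ n)"
    using assms by (intro summable_geometric) auto
qed

definition is_maximizer :: "real \<Rightarrow> real \<Rightarrow> bool" where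
  "is_maximizer \<alpha> t \<longleftrightarrow> is_arg_max (takagi \<alpha>) (\<lambda>s. s \<in> {0..1}) t"

definition littlewood :: "real poly \<Rightarrow> bool" where
  "littlewood P \<longleftrightarrow> (\<forall>m\<le>degree P. coeff P m \<in> {-1, 1})"

text \<open>\<^term>\<open>poly_cutoff (Suc k) P\<close> keeps exactly the terms of degree at most \<^term>\<open>k\<close>, i.e. it is
  the partial sum of index \<^term>\<open>k\<close>.  Only polynomials of positive degree are considered.\<close>

definition step_root :: "real poly \<Rightarrow> real \<Rightarrow> bool" where
  "step_root P \<alpha> \<longleftrightarrow> degree P \<ge> 1 \<and> poly P \<alpha> = 0 \<and>
     (\<forall>k<degree P. coeff P (Suc k) * poly (poly_cutoff (Suc k) P) \<alpha> \<le> 0)"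

end

theory Submission
  imports Defs
begin

text \<open>Write \<open>t\<close> in binary with digits \<open>(1 - \<rho> m) / 2\<close>, and let \<open>P n = (\<Sum>m<n. \<rho> m * \<alpha> ^ m)\<close>.
  Then the Takagi function at \<open>t\<close> is a constant minus \<open>(\<Sum>n. \<rho> n * P n / 2 ^ n) / 4\<close>. Negating all
  signs from index \<open>n\<close> on changes this value by a nonnegative multiple of \<open>\<rho> n * P n\<close>, so a maximizer
  has an expansion with \<open>\<rho> n * P n \<le> 0\<close> for all \<open>n\<close>. Conversely this step condition determines
  \<open>\<bar>P n\<bar>\<close> recursively, hence the value, so that all sequences satisfying it give maximizers. Up to a
  global sign, the sequence is unique unless some \<open>P n\<close> with \<open>n > 0\<close> vanishes, i.e. unless \<open>\<alpha>\<close> is a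
  step root. In that case flipping at \<open>n\<close> gives a second sequence; it represents a different
  point because the remaining signs cannot be \<open>\<rho> n, - \<rho> n, - \<rho> n, \<dots>\<close>.\<close>

definition signs :: "(nat \<Rightarrow> real) \<Rightarrow> bool" where
  "signs \<rho> \<longleftrightarrow> (\<forall>n. \<rho> n \<in> {-1, 1})"

text \<open>For a sign sequence, \<open>1 / 2 - tail \<rho> n / 4\<close> is the number in [0, 1]
  whose binary digits are those of \<open>rademacher_point \<rho>\<close> from index
  \<open>n\<close> on. Thus \<open>tail\<close> lies in [-2, 2], and the value 0 corresponds to the
  number 1/2.\<close>

definition tail :: "(nat \<Rightarrow> real) \<Rightarrow> nat \<Rightarrow> real" where
  "tail \<rho> n = (\<Sum>k. \<rho> (n + k) / 2 ^ k)"

text \<open>This is \<open>(\<Sum>m. (1 - \<rho> m) / 2 ^ (m + 2))\<close>, the number whose binary digits are \<open>(1 - \<rho> m) / 2\<close>.\<close>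

definition rademacher_point :: "(nat \<Rightarrow> real) \<Rightarrow> real" where
  "rademacher_point \<rho> = 1 / 2 - tail \<rho> 0 / 4"

definition psum :: "real \<Rightarrow> (nat \<Rightarrow> real) \<Rightarrow> nat \<Rightarrow> real" where
  "psum \<alpha> \<rho> n = (\<Sum>m<n. \<rho> m * \<alpha> ^ m)"

definition flip :: "nat \<Rightarrow> (nat \<Rightarrow> real) \<Rightarrow> nat \<Rightarrow> real" where
  "flip n \<rho> m = (if m < n then \<rho> m else - \<rho> m)"

text \<open>The infinite analogue of the step root condition. Since \<open>psum\<close> at
  \<open>n\<close> stops before index \<open>n\<close>, the case \<open>n = k + 1\<close> is the
  inequality for \<open>k\<close>, and \<open>n = 0\<close> is vacuous.\<close>

definition step_seq :: "real \<Rightarrow> (nat \<Rightarrow> real) \<Rightarrow> bool" where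
  "step_seq \<alpha> \<rho> \<longleftrightarrow> signs \<rho> \<and> (\<forall>n. \<rho> n * psum \<alpha> \<rho> n \<le> 0)"

subsection \<open>Sign sequences and binary expansions\<close>

lemma signsD: "signs \<rho> \<Longrightarrow> \<rho> n = -1 \<or> \<rho> n = 1"
  by (auto simp: signs_def)

lemma signs_flip: "signs \<rho> \<Longrightarrow> signs (flip n \<rho>)"
  by (force simp: signs_def flip_def)

lemma summable_tail:
  assumes "signs \<rho>"
  shows "summable (\<lambda>k. \<rho> (n + k) / 2 ^ k)"
proof (rule summable_comparison_test)
  have "\<bar>\<rho> m\<bar> = 1" for m
    using signsD[OF assms, of m] by auto
  then show "\<exists>N. \<forall>k\<ge>N. norm (\<rho> (n + k) / 2 ^ k) \<le> (1 / 2) ^ k"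
    by (simp add: abs_divide power_divide)
  show "summable (\<lambda>k. (1 / 2 :: real) ^ k)"
    by (rule summable_geometric) auto
qed

lemma tail_rec:
  assumes "signs \<rho>"
  shows "tail \<rho> n = \<rho> n + tail \<rho> (Suc n) / 2"
proof -
  have "tail \<rho> n = \<rho> (n + 0) / 2 ^ 0 + (\<Sum>k. \<rho> (n + Suc k) / 2 ^ Suc k)"
    unfolding tail_def using suminf_split_head[OF summable_tail[OF assms, of n]] by simp
  also have "(\<Sum>k. \<rho> (n + Suc k) / 2 ^ Suc k) = (\<Sum>k. \<rho> (Suc n + k) / 2 ^ k / 2)"
    by (simp add: field_simps)
  also have "\<dots> = tail \<rho> (Suc n) / 2"
    unfolding tail_def by (rule suminf_divide[OF summable_tail[OF assms]])
  finally show ?thesis by simp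
qed

lemma tail_le:
  assumes "signs \<rho>"
  shows "tail \<rho> n \<le> 2"
proof -
  have "tail \<rho> n \<le> (\<Sum>k. (1 / 2 :: real) ^ k)"
    unfolding tail_def
  proof (rule suminf_le[OF _ summable_tail[OF assms]])
    show "\<rho> (n + k) / 2 ^ k \<le> (1 / 2) ^ k" for k
      using signsD[OF assms, of "n + k"] by (auto simp: power_divide divide_right_mono)
  qed (simp add: summable_geometric)
  also have "\<dots> = 2"
    by (simp add: suminf_geometric)
  finally show ?thesis .
qed

lemma tail_flip:
  assumes "signs \<rho>" "n \<le> m"
  shows "tail (flip n \<rho>) m = - tail \<rho> m"
proof -
  have "tail (flip n \<rho>) m = (\<Sum>k. - (\<rho> (m + k) / 2 ^ k))"
    unfolding tail_def using assms(2) by (simp add: flip_def)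
  also have "\<dots> = - tail \<rho> m"
    unfolding tail_def by (rule suminf_minus[OF summable_tail[OF assms(1)]])
  finally show ?thesis .
qed

lemma tail_ge:
  assumes "signs \<rho>"
  shows "- 2 \<le> tail \<rho> n"
  using tail_le[OF signs_flip[OF assms, of 0], of n] tail_flip[OF assms, of 0 n] by simp

lemma sign_times_tail_nonneg:
  assumes "signs \<rho>"
  shows "0 \<le> \<rho> n * tail \<rho> n"
  using signsD[OF assms, of n] tail_rec[OF assms, of n]
    tail_le[OF assms, of "Suc n"] tail_ge[OF assms, of "Suc n"]
  by auto

text \<open>In \<open>tail_rec\<close> an extreme value forces both summands to be extreme, so the
  sign is \<open>s\<close> and the next tail is extreme again.\<close>

lemma tail_extremal:
  assumes "signs \<rho>" "tail \<rho> n = 2 * s" "s = 1 \<or> s = - 1"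
  shows "tail \<rho> (n + k) = 2 * s \<and> \<rho> (n + k) = s"
proof -
  have "\<rho> m = s \<and> tail \<rho> (Suc m) = 2 * s" if "tail \<rho> m = 2 * s" for m
    using that assms(3) signsD[OF assms(1), of m] tail_rec[OF assms(1), of m]
      tail_le[OF assms(1), of "Suc m"] tail_ge[OF assms(1), of "Suc m"]
    by auto
  with assms(2) show ?thesis
    by (induction k) auto
qed

text \<open>The number 1/2 has only the expansions 0111... and 1000...: a zero tail makes the next
  tail equal to \<open>- 2 * \<rho> n\<close>, which is extremal.\<close>

lemma tail_eq_0:
  assumes "signs \<rho>" "tail \<rho> n = 0" "n < m"
  shows "\<rho> m = - \<rho> n"
proof -
  have "tail \<rho> (Suc n) = 2 * (- \<rho> n)"
    using tail_rec[OF assms(1), of n] assms(2) by simp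
  from tail_extremal[OF assms(1) this, of "m - Suc n"] signsD[OF assms(1), of n] assms(3)
  show ?thesis by auto
qed

text \<open>After a zero at \<open>a\<close> the signs are constant, whereas a zero at a later
  \<open>b\<close> would need a sign change from \<open>b\<close> to \<open>Suc b\<close>.\<close>

lemma tail_eq_0_unique:
  assumes "signs \<rho>" "tail \<rho> a = 0" "tail \<rho> b = 0"
  shows "a = b"
proof -
  have False if "tail \<rho> a = 0" "tail \<rho> b = 0" "a < b" for a b
    using tail_eq_0[OF assms(1) that(1), of b] tail_eq_0[OF assms(1) that(1), of "Suc b"]
      tail_eq_0[OF assms(1) that(2), of "Suc b"] that(3) signsD[OF assms(1), of a]
    by auto
  with assms(2,3) show ?thesis
    by (metis linorder_neqE_nat)
qed

text \<open>At \<open>n\<close> the flip negates the tail; each step down from \<open>n\<close>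
  halves the difference by \<open>tail_rec\<close>.\<close>

lemma tail_flip_before:
  assumes "signs \<rho>" "m \<le> n"
  shows "tail (flip n \<rho>) m - tail \<rho> m = - 2 * tail \<rho> n * 2 ^ m / 2 ^ n"
  using assms(2)
proof (induction rule: inc_induct)
  case base
  show ?case by (simp add: tail_flip[OF assms(1)])
next
  case (step m)
  have "flip n \<rho> m = \<rho> m"
    using step.hyps by (simp add: flip_def)
  then have "tail (flip n \<rho>) m - tail \<rho> m = (tail (flip n \<rho>) (Suc m) - tail \<rho> (Suc m)) / 2"
    using tail_rec[OF assms(1), of m] tail_rec[OF signs_flip[OF assms(1)], of n m] by simp
  with step.IH show ?case by simp
qed

text \<open>In particular the flip yields the same point exactly when \<open>tail \<rho> n\<close>
  vanishes.\<close>

lemma rademacher_point_flip: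
  assumes "signs \<rho>"
  shows "rademacher_point (flip n \<rho>) = rademacher_point \<rho> + tail \<rho> n / 2 / 2 ^ n"
  using tail_flip_before[OF assms, of 0 n] by (simp add: rademacher_point_def field_simps)

lemma rademacher_point_bounds:
  assumes "signs \<rho>"
  shows "rademacher_point \<rho> \<in> {0..1}"
  using tail_le[OF assms, of 0] tail_ge[OF assms, of 0] by (simp add: rademacher_point_def)

lemma rademacher_point_bounds_half:
  assumes "signs \<rho>" "\<rho> 0 = 1"
  shows "rademacher_point \<rho> \<in> {0..1/2}"
  using rademacher_point_bounds[OF assms(1)] sign_times_tail_nonneg[OF assms(1), of 0] assms(2)
  by (simp add: rademacher_point_def)

lemma rademacher_point_surj:
  assumes "t \<in> {0..1}"
  obtains \<rho> where "signs \<rho>" "rademacher_point \<rho> = t"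
proof (cases "t = 1")
  case True
  let ?\<rho> = "\<lambda>_::nat. - 1 :: real"
  have "signs ?\<rho>" by (simp add: signs_def)
  moreover have "tail ?\<rho> 0 = - 2"
    using tail_rec[OF \<open>signs ?\<rho>\<close>, of 0] by (simp add: tail_def)
  ultimately show ?thesis
    using that True by (simp add: rademacher_point_def)
next
  case False
  \<comment> \<open>These are the binary digits of \<open>t\<close> obtained by rounding down. For
    \<open>t = 1\<close> they would all be 0, which is why that point is treated apart.\<close>
  define b where "b m = \<lfloor>2 ^ Suc m * t\<rfloor> - 2 * \<lfloor>2 ^ m * t\<rfloor>" for m :: nat
  define \<rho> where "\<rho> m = 1 - 2 * real_of_int (b m)" for m
  have "b m = 0 \<or> b m = 1" for m
  proof -
    have "2 ^ Suc m * t = 2 * (2 ^ m * t)" by simp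
    then show ?thesis unfolding b_def by linarith
  qed
  then have \<rho>: "signs \<rho>"
    unfolding signs_def \<rho>_def by fastforce
  \<comment> \<open>The digit sums telescope. The base case needs
    \<open>\<lfloor>t\<rfloor> = 0\<close>, hence \<open>t \<noteq> 1\<close>.\<close>
  have psum: "(\<Sum>m<N. \<rho> m / 2 ^ m) = 2 - 2 / 2 ^ N - 4 * (real_of_int \<lfloor>2 ^ N * t\<rfloor> / 2 ^ N)" for N
  proof (induction N)
    case 0
    have "\<lfloor>t\<rfloor> = 0" using assms False by (simp add: floor_eq_iff)
    then show ?case by simp
  next
    case (Suc N)
    have "\<rho> N / 2 ^ N = 1 / 2 ^ N - (2 * real_of_int \<lfloor>2 ^ Suc N * t\<rfloor> - 4 * real_of_int \<lfloor>2 ^ N * t\<rfloor>) / 2 ^ N"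
      by (simp add: \<rho>_def b_def diff_divide_distrib)
    then show ?case
      unfolding sum.lessThan_Suc Suc.IH by (simp add: diff_divide_distrib)
  qed
  have fl: "(\<lambda>N. real_of_int \<lfloor>2 ^ N * t\<rfloor> / 2 ^ N) \<longlonglongrightarrow> t"
  proof (rule tendsto_sandwich)
    have "(\<lambda>N. (1 / 2 :: real) ^ N) \<longlonglongrightarrow> 0"
      by (rule LIMSEQ_power_zero) simp
    then have "(\<lambda>N. t - (1 / 2) ^ N) \<longlonglongrightarrow> t - 0"
      by (intro tendsto_diff tendsto_const)
    then show "(\<lambda>N. t - (1 / 2) ^ N) \<longlonglongrightarrow> t" by simp
    show "\<forall>\<^sub>F N in sequentially. t - (1 / 2) ^ N \<le> real_of_int \<lfloor>2 ^ N * t\<rfloor> / 2 ^ N"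
    proof (intro always_eventually allI)
      fix N :: nat
      have "2 ^ N * t - 1 \<le> real_of_int \<lfloor>2 ^ N * t\<rfloor>" by linarith
      then have "(2 ^ N * t - 1) / 2 ^ N \<le> real_of_int \<lfloor>2 ^ N * t\<rfloor> / 2 ^ N"
        by (rule divide_right_mono) simp
      then show "t - (1 / 2) ^ N \<le> real_of_int \<lfloor>2 ^ N * t\<rfloor> / 2 ^ N"
        by (simp add: diff_divide_distrib power_divide)
    qed
    show "\<forall>\<^sub>F N in sequentially. real_of_int \<lfloor>2 ^ N * t\<rfloor> / 2 ^ N \<le> t"
      by (intro always_eventually allI) (simp add: divide_le_eq mult.commute)
  qed simp
  have "(\<lambda>N. 2 - 2 * (1 / 2) ^ N - 4 * (real_of_int \<lfloor>2 ^ N * t\<rfloor> / 2 ^ N)) \<longlonglongrightarrow> 2 - 2 * 0 - 4 * t"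
    by (intro tendsto_diff tendsto_mult tendsto_const fl LIMSEQ_power_zero) simp
  then have "(\<lambda>k. \<rho> (0 + k) / 2 ^ k) sums (2 - 4 * t)"
    unfolding sums_def using psum by (simp add: power_divide)
  then have "tail \<rho> 0 = 2 - 4 * t"
    unfolding tail_def by (rule sums_unique[symmetric])
  then have "rademacher_point \<rho> = t"
    by (simp add: rademacher_point_def diff_divide_distrib)
  with \<rho> show ?thesis by (rule that)
qed

subsection \<open>The Takagi function along sign sequences\<close>

lemma tent_lipschitz: "\<bar>tent x - tent y\<bar> \<le> \<bar>x - y\<bar>"
proof -
  have le: "tent x \<le> tent y + \<bar>x - y\<bar>" for x y
  proof -
    obtain z where "z \<in> \<int>" "tent y = \<bar>y - z\<bar>"
      using tent_is_min[of y] by blast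
    moreover have "tent x \<le> \<bar>x - z\<bar>"
      using tent_is_min[of x] \<open>z \<in> \<int>\<close> by metis
    ultimately show ?thesis by linarith
  qed
  show ?thesis using le[of x y] le[of y x] by linarith
qed

lemma tent_bounds: "0 \<le> tent x" "tent x \<le> 1"
proof -
  obtain z where z: "tent x = \<bar>x - z\<bar>" "\<forall>w\<in>\<int>. \<bar>x - z\<bar> \<le> \<bar>x - w\<bar>"
    using tent_is_min by blast
  show "0 \<le> tent x" using z by simp
  have "\<bar>x - z\<bar> \<le> \<bar>x - of_int \<lfloor>x\<rfloor>\<bar>" using z(2) Ints_of_int by blast
  then show "tent x \<le> 1" using z(1) by linarith
qed

lemma tent_eq:
  assumes "j \<in> \<int>" "x \<in> {0..1}"
  shows "tent (j + x) = min x (1 - x)"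
proof -
  obtain z where z: "z \<in> \<int>" "tent (j + x) = \<bar>j + x - z\<bar>" "\<forall>w\<in>\<int>. \<bar>j + x - z\<bar> \<le> \<bar>j + x - w\<bar>"
    using tent_is_min by blast
  have "\<bar>j + x - z\<bar> \<le> \<bar>j + x - j\<bar>" "\<bar>j + x - z\<bar> \<le> \<bar>j + x - (j + 1)\<bar>"
    using z(3) assms(1) Ints_add[OF assms(1) Ints_1] by blast+
  moreover have "z - j \<le> 0 \<or> 1 \<le> z - j"
  proof -
    have "z - j \<in> \<int>" using z(1) assms(1) by simp
    then obtain i :: int where "z - j = of_int i" by (auto elim: Ints_cases)
    then show ?thesis by (cases "i \<le> 0") auto
  qed
  ultimately show ?thesis using z(2) assms(2) by (auto simp: min_def)
qed

text \<open>Doubling shifts the binary expansion by one place, and the digit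
  \<open>(1 - \<rho> m) / 2\<close> moves into the integer part.\<close>

lemma rademacher_point_scaled:
  assumes "signs \<rho>"
  shows "2 ^ m * rademacher_point \<rho> - (1 / 2 - tail \<rho> m / 4) \<in> \<int>"
proof (induction m)
  case 0
  show ?case by (simp add: rademacher_point_def)
next
  case (Suc m)
  have "(1 - \<rho> m) / 2 \<in> \<int>"
    using signsD[OF assms, of m] by auto
  moreover have "2 ^ Suc m * rademacher_point \<rho> - (1 / 2 - tail \<rho> (Suc m) / 4) =
      2 * (2 ^ m * rademacher_point \<rho> - (1 / 2 - tail \<rho> m / 4)) + (1 - \<rho> m) / 2"
    using tail_rec[OF assms, of m] by (simp add: field_simps)
  ultimately show ?case
    using Suc.IH by (metis Ints_add Ints_mult Ints_numeral)
qed

text \<open>The distance to the nearest integer is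
  \<open>1 / 2 - \<bar>tail \<rho> m\<bar> / 4\<close>. As the tail has the sign of its first term,
  its absolute value is \<open>\<rho> m * tail \<rho> m = 1 + \<rho> m * tail \<rho> (Suc m) /
  2\<close>.\<close>

lemma tent_rademacher_point:
  assumes "signs \<rho>"
  shows "tent (2 ^ m * rademacher_point \<rho>) = (1 - \<rho> m * tail \<rho> (Suc m) / 2) / 4"
proof -
  have "1 / 2 - tail \<rho> m / 4 \<in> {0..1}"
    using tail_le[OF assms, of m] tail_ge[OF assms, of m] by simp
  from tent_eq[OF rademacher_point_scaled[OF assms] this]
  have "tent (2 ^ m * rademacher_point \<rho>) =
      min (1 / 2 - tail \<rho> m / 4) (1 - (1 / 2 - tail \<rho> m / 4))"
    by (metis diff_add_cancel)
  then show ?thesis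
    using signsD[OF assms, of m] tail_rec[OF assms, of m] sign_times_tail_nonneg[OF assms, of m]
    by (auto simp: min_def field_simps)
qed

definition takagi_partial :: "real \<Rightarrow> (nat \<Rightarrow> real) \<Rightarrow> nat \<Rightarrow> real" where
  "takagi_partial \<alpha> \<rho> N = (\<Sum>m<N. \<alpha> ^ m / 2 ^ m * ((1 - \<rho> m * tail \<rho> (Suc m) / 2) / 4))"

lemma takagi_partial_tendsto:
  assumes "\<alpha> \<in> {-2<..<2}" "signs \<rho>"
  shows "takagi_partial \<alpha> \<rho> \<longlonglongrightarrow> takagi \<alpha> (rademacher_point \<rho>)"
  using summable_LIMSEQ[OF takagi_summable[OF assms(1), of "rademacher_point \<rho>"]]
  by (simp add: takagi_def takagi_partial_def[abs_def] tent_rademacher_point[OF assms(2)])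

text \<open>In the terms with \<open>m \<ge> n\<close> both the sign and the tail are negated, so
  only the finitely many terms before \<open>n\<close> change. Because \<open>tail \<rho> n\<close>
  has the sign of \<open>\<rho> n\<close>, the increment is a nonnegative multiple of
  \<open>\<rho> n * psum \<alpha> \<rho> n\<close>.\<close>

lemma takagi_flip:
  assumes "\<alpha> \<in> {-2<..<2}" "signs \<rho>"
  shows "takagi \<alpha> (rademacher_point (flip n \<rho>)) =
    takagi \<alpha> (rademacher_point \<rho>) + psum \<alpha> \<rho> n * tail \<rho> n / 2 / 2 ^ n"
proof -
  let ?d = "\<lambda>m. \<alpha> ^ m / 2 ^ m * ((1 - flip n \<rho> m * tail (flip n \<rho>) (Suc m) / 2) / 4) -
      \<alpha> ^ m / 2 ^ m * ((1 - \<rho> m * tail \<rho> (Suc m) / 2) / 4)"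
  have before: "?d m = \<rho> m * \<alpha> ^ m * (tail \<rho> n / 2 / 2 ^ n)" if "m < n" for m
  proof -
    have "tail (flip n \<rho>) (Suc m) = tail \<rho> (Suc m) - 2 * tail \<rho> n * 2 ^ Suc m / 2 ^ n"
      using tail_flip_before[OF assms(2), of "Suc m" n] that by simp
    moreover have "flip n \<rho> m = \<rho> m"
      using that by (simp add: flip_def)
    ultimately show ?thesis by (simp only:) (simp add: field_simps)
  qed
  have after: "?d m = 0" if "n \<le> m" for m
    using that by (simp add: flip_def tail_flip[OF assms(2)])
  have "takagi_partial \<alpha> (flip n \<rho>) N - takagi_partial \<alpha> \<rho> N = psum \<alpha> \<rho> n * tail \<rho> n / 2 / 2 ^ n"
    if "n \<le> N" for N
  proof -
    have "takagi_partial \<alpha> (flip n \<rho>) N - takagi_partial \<alpha> \<rho> N = (\<Sum>m<N. ?d m)"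
      by (simp add: takagi_partial_def sum_subtractf)
    also have "\<dots> = (\<Sum>m<n. ?d m)"
      using that after by (intro sum.mono_neutral_right) auto
    also have "\<dots> = (\<Sum>m<n. \<rho> m * \<alpha> ^ m * (tail \<rho> n / 2 / 2 ^ n))"
      using before by (intro sum.cong) auto
    finally show ?thesis by (simp add: psum_def sum_distrib_right sum_divide_distrib)
  qed
  then have "(\<lambda>N. takagi_partial \<alpha> (flip n \<rho>) N - takagi_partial \<alpha> \<rho> N)
      \<longlonglongrightarrow> psum \<alpha> \<rho> n * tail \<rho> n / 2 / 2 ^ n"
    by (intro tendsto_eventually) (auto simp: eventually_sequentially)
  moreover have "(\<lambda>N. takagi_partial \<alpha> (flip n \<rho>) N - takagi_partial \<alpha> \<rho> N)
      \<longlonglongrightarrow> takagi \<alpha> (rademacher_point (flip n \<rho>)) - takagi \<alpha> (rademacher_point \<rho>)"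
    by (intro tendsto_diff takagi_partial_tendsto assms signs_flip)
  ultimately show ?thesis
    using LIMSEQ_unique by fastforce
qed

text \<open>Expanding the tails gives a double sum over \<open>m < n\<close> of
  \<open>\<rho> m * \<alpha> ^ m * \<rho> n / 2 ^ n\<close>. Collecting it by \<open>n\<close>
  produces \<open>psum\<close>, and the indices \<open>n \<ge> N\<close> form the remainder. The
  induction carries this out through \<open>tail_rec\<close>.\<close>

lemma takagi_partial_eq:
  assumes "signs \<rho>"
  shows "takagi_partial \<alpha> \<rho> N = ((\<Sum>m<N. \<alpha> ^ m / 2 ^ m) - (\<Sum>n<N. \<rho> n * psum \<alpha> \<rho> n / 2 ^ n)
    - psum \<alpha> \<rho> N * tail \<rho> N / 2 ^ N) / 4"
proof (induction N)
  case 0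
  show ?case by (simp add: takagi_partial_def psum_def)
next
  case (Suc N)
  define A where "A = (\<Sum>m<N. \<alpha> ^ m / 2 ^ m)"
  define B where "B = (\<Sum>n<N. \<rho> n * psum \<alpha> \<rho> n / 2 ^ n)"
  have "takagi_partial \<alpha> \<rho> (Suc N) = (A - B - psum \<alpha> \<rho> N * (\<rho> N + tail \<rho> (Suc N) / 2) / 2 ^ N) / 4 +
      \<alpha> ^ N / 2 ^ N * ((1 - \<rho> N * tail \<rho> (Suc N) / 2) / 4)"
    using Suc tail_rec[OF assms, of N] by (simp add: takagi_partial_def A_def B_def)
  moreover have "psum \<alpha> \<rho> (Suc N) = psum \<alpha> \<rho> N + \<rho> N * \<alpha> ^ N"
    by (simp add: psum_def)
  ultimately show ?case
    unfolding sum.lessThan_Suc A_def[symmetric] B_def[symmetric]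
    by (simp only:) (simp add: field_simps)
qed

section \<open>Growth of the partial sums and decay of the remainder\<close>

lemma abs_psum_le:
  assumes "signs \<rho>" "\<bar>\<alpha>\<bar> \<le> b" "1 \<le> b"
  shows "\<bar>psum \<alpha> \<rho> N\<bar> \<le> real N * b ^ N"
proof -
  have "\<bar>psum \<alpha> \<rho> N\<bar> \<le> (\<Sum>m<N. \<bar>\<rho> m * \<alpha> ^ m\<bar>)"
    unfolding psum_def by (rule sum_abs)
  also have "\<dots> \<le> (\<Sum>m<N. b ^ N)"
  proof (rule sum_mono)
    fix m assume "m \<in> {..<N}"
    have "\<bar>\<rho> m * \<alpha> ^ m\<bar> = \<bar>\<alpha>\<bar> ^ m"
      using signsD[OF assms(1), of m] by (auto simp: abs_mult power_abs)
    also have "\<dots> \<le> b ^ m" using assms(2) by (intro power_mono) auto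
    also have "\<dots> \<le> b ^ N" using \<open>m \<in> {..<N}\<close> assms(3) by (intro power_increasing) auto
    finally show "\<bar>\<rho> m * \<alpha> ^ m\<bar> \<le> b ^ N" .
  qed
  finally show ?thesis by simp
qed

lemma psum_tail_tendsto_0:
  assumes "\<alpha> \<in> {-2<..<2}" "signs \<rho>"
  shows "(\<lambda>N. psum \<alpha> \<rho> N * tail \<rho> N / 2 ^ N) \<longlonglongrightarrow> 0"
proof (rule Lim_null_comparison)
  \<comment> \<open>The maximum with 1 covers small \<alpha> as well and still leaves
    \<open>b < 2\<close>, so that \<open>N * b ^ N\<close> is negligible against
    \<open>2 ^ N\<close>.\<close>
  define b where "b = max \<bar>\<alpha>\<bar> 1"
  have b: "\<bar>\<alpha>\<bar> \<le> b" "1 \<le> b" "b < 2" using assms(1) by (auto simp: b_def)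
  show "\<forall>\<^sub>F N in sequentially. norm (psum \<alpha> \<rho> N * tail \<rho> N / 2 ^ N) \<le> 2 * (real N * (b / 2) ^ N)"
  proof (intro always_eventually allI)
    fix N
    have "\<bar>psum \<alpha> \<rho> N\<bar> * \<bar>tail \<rho> N\<bar> \<le> (real N * b ^ N) * 2"
      using abs_psum_le[OF assms(2) b(1,2), of N] tail_le[OF assms(2), of N]
        tail_ge[OF assms(2), of N] b(2)
      by (intro mult_mono) auto
    then show "norm (psum \<alpha> \<rho> N * tail \<rho> N / 2 ^ N) \<le> 2 * (real N * (b / 2) ^ N)"
      by (simp add: abs_mult power_divide divide_right_mono mult_ac)
  qed
  have "(\<lambda>N. real N * (b / 2) ^ N) \<longlonglongrightarrow> 0"
    using b by (intro powser_times_n_limit_0) auto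
  from tendsto_mult_right_zero[OF this, of 2]
  show "(\<lambda>N. 2 * (real N * (b / 2) ^ N)) \<longlonglongrightarrow> 0" .
qed

section \<open>Continuity and existence of a maximizer\<close>

lemma takagi_continuous:
  assumes "\<alpha> \<in> {-2<..<2}"
  shows "continuous_on {0..1} (takagi \<alpha>)"
  unfolding takagi_def[abs_def]
proof (rule uniform_limit_theorem)
  show "\<forall>\<^sub>F N in sequentially. continuous_on {0..1}
      (\<lambda>t. \<Sum>m<N. \<alpha> ^ m / 2 ^ m * tent (2 ^ m * t))"
  proof (intro always_eventually allI continuous_intros)
    have "1-lipschitz_on UNIV tent"
      using tent_lipschitz by (intro lipschitz_onI) (auto simp: dist_real_def)
    then have "continuous_on UNIV tent"
      by (rule lipschitz_on_continuous_on)
    then show "continuous_on {0..1} (\<lambda>t. tent (2 ^ m * t))" for m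
      by (rule continuous_on_compose2) (auto intro: continuous_intros)
  qed
  show "uniform_limit {0..1} (\<lambda>N t. \<Sum>m<N. \<alpha> ^ m / 2 ^ m * tent (2 ^ m * t))
      (\<lambda>t. \<Sum>m. \<alpha> ^ m / 2 ^ m * tent (2 ^ m * t)) sequentially"
  proof (rule Weierstrass_m_test)
    show "norm (\<alpha> ^ n / 2 ^ n * tent (2 ^ n * t)) \<le> \<bar>\<alpha> / 2\<bar> ^ n" for n t
      using tent_bounds[of "2 ^ n * t"]
        mult_left_mono[of "tent (2 ^ n * t)" 1 "\<bar>\<alpha>\<bar> ^ n / 2 ^ n"]
      by (simp add: abs_mult power_abs power_divide)
    show "summable (\<lambda>n. \<bar>\<alpha> / 2\<bar> ^ n)"
      using assms by (intro summable_geometric) auto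
  qed
qed simp

lemma maximizer_exists:
  assumes "\<alpha> \<in> {-2<..<2}"
  obtains t where "is_maximizer \<alpha> t"
proof -
  obtain t where "t \<in> {0..1}" "\<forall>s\<in>{0..1}. takagi \<alpha> s \<le> takagi \<alpha> t"
    using continuous_attains_sup[OF _ _ takagi_continuous[OF assms]] by auto
  then have "is_maximizer \<alpha> t"
    by (force simp: is_maximizer_def is_arg_max_def)
  then show ?thesis by (rule that)
qed

subsection \<open>Maximizers and the step condition\<close>

lemma psum_0 [simp]: "psum \<alpha> \<rho> 0 = 0"
  by (simp add: psum_def)

lemma psum_Suc: "psum \<alpha> \<rho> (Suc n) = psum \<alpha> \<rho> n + \<rho> n * \<alpha> ^ n"
  by (simp add: psum_def)

lemma psum_cong: "(\<And>m. m < n \<Longrightarrow> \<rho> m = \<rho>' m) \<Longrightarrow> psum \<alpha> \<rho> n = psum \<alpha> \<rho>' n"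
  by (simp add: psum_def)

lemma step_seq_signs: "step_seq \<alpha> \<rho> \<Longrightarrow> signs \<rho>"
  by (simp add: step_seq_def)

lemma step_seq_times: "step_seq \<alpha> \<rho> \<Longrightarrow> \<rho> n * psum \<alpha> \<rho> n = - \<bar>psum \<alpha> \<rho> n\<bar>"
  using signsD[of \<rho> n] by (auto simp: step_seq_def dest: spec[of _ n])

text \<open>Multiplying the new partial sum by \<open>- \<rho> n\<close> turns it into
  \<open>\<bar>psum \<alpha> \<rho> n\<bar> - \<alpha> ^ n\<close>. The resulting recursion for the
  absolute values no longer involves the signs.\<close>

lemma step_seq_abs_psum:
  assumes "step_seq \<alpha> \<rho>"
  shows "\<bar>psum \<alpha> \<rho> (Suc n)\<bar> = \<bar>\<bar>psum \<alpha> \<rho> n\<bar> - \<alpha> ^ n\<bar>"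
  using step_seq_times[OF assms, of n] signsD[OF step_seq_signs[OF assms], of n]
  by (auto simp: psum_Suc)

lemma step_seq_abs_psum_eq:
  assumes "step_seq \<alpha> \<rho>" "step_seq \<alpha> \<rho>'"
  shows "\<bar>psum \<alpha> \<rho> n\<bar> = \<bar>psum \<alpha> \<rho>' n\<bar>"
  by (induction n) (simp_all add: step_seq_abs_psum[OF assms(1)] step_seq_abs_psum[OF assms(2)])

text \<open>In \<open>takagi_partial_eq\<close> each
  \<open>\<rho> n * psum \<alpha> \<rho> n\<close> is
  \<open>- \<bar>psum \<alpha> \<rho> n\<bar>\<close>, the same for both sequences. Only the
  remainders differ, and they tend to 0.\<close>

lemma step_seq_takagi_eq:
  assumes "\<alpha> \<in> {-2<..<2}" "step_seq \<alpha> \<rho>" "step_seq \<alpha> \<rho>'"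
  shows "takagi \<alpha> (rademacher_point \<rho>) = takagi \<alpha> (rademacher_point \<rho>')"
proof -
  note s = step_seq_signs[OF assms(2)] step_seq_signs[OF assms(3)]
  have "(\<lambda>N. (psum \<alpha> \<rho>' N * tail \<rho>' N / 2 ^ N - psum \<alpha> \<rho> N * tail \<rho> N / 2 ^ N) / 4) \<longlonglongrightarrow> (0 - 0) / 4"
    by (intro tendsto_intros psum_tail_tendsto_0 assms(1) s) simp
  moreover have "(psum \<alpha> \<rho>' N * tail \<rho>' N / 2 ^ N - psum \<alpha> \<rho> N * tail \<rho> N / 2 ^ N) / 4 =
      takagi_partial \<alpha> \<rho> N - takagi_partial \<alpha> \<rho>' N" for N
    by (simp add: takagi_partial_eq s step_seq_times[OF assms(2)] step_seq_times[OF assms(3)]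
        step_seq_abs_psum_eq[OF assms(2,3)] field_simps)
  moreover have "(\<lambda>N. takagi_partial \<alpha> \<rho> N - takagi_partial \<alpha> \<rho>' N)
      \<longlonglongrightarrow> takagi \<alpha> (rademacher_point \<rho>) - takagi \<alpha> (rademacher_point \<rho>')"
    by (intro tendsto_diff takagi_partial_tendsto assms(1) s)
  ultimately show ?thesis
    using LIMSEQ_unique by fastforce
qed

lemma maximizer_step_seq:
  assumes "\<alpha> \<in> {-2<..<2}" "is_maximizer \<alpha> t"
  obtains \<rho> where "step_seq \<alpha> \<rho>" "rademacher_point \<rho> = t"
proof -
  \<comment> \<open>If the step condition fails at \<open>n\<close>, flipping there cannot increase
    the value at the maximizer \<open>t\<close>, so the factor \<open>tail \<rho> n\<close> in
    \<open>takagi_flip\<close> must vanish.\<close>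
  have tail_0: "tail \<rho> n = 0"
    if "signs \<rho>" "rademacher_point \<rho> = t" "\<rho> n * psum \<alpha> \<rho> n > 0" for \<rho> n
  proof -
    have "takagi \<alpha> (rademacher_point (flip n \<rho>)) \<le> takagi \<alpha> t"
      using assms(2) rademacher_point_bounds[OF signs_flip[OF that(1)], of n]
      by (auto simp: is_maximizer_def is_arg_max_def not_less)
    then have "psum \<alpha> \<rho> n * tail \<rho> n \<le> 0"
      using takagi_flip[OF assms(1) that(1), of n] that(2) by (simp add: pos_divide_le_eq)
    then show ?thesis
      using sign_times_tail_nonneg[OF that(1), of n] signsD[OF that(1), of n] that(3)
      by (auto simp: mult_le_0_iff)
  qed
  obtain \<rho> where \<rho>: "signs \<rho>" "rademacher_point \<rho> = t"
    using rademacher_point_surj assms(2) by (auto simp: is_maximizer_def is_arg_max_def)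
  show ?thesis
  proof (cases "step_seq \<alpha> \<rho>")
    case True
    then show ?thesis using that \<rho> by blast
  next
    case False
    then obtain n where n: "\<rho> n * psum \<alpha> \<rho> n > 0"
      using \<rho>(1) by (auto simp: step_seq_def not_le)
    \<comment> \<open>Then \<open>t\<close> is a dyadic rational and \<open>flip n \<rho>\<close> is its other binary expansion.\<close>
    have zero: "tail \<rho> n = 0" by (rule tail_0[OF \<rho> n])
    let ?\<rho>' = "flip n \<rho>"
    have s': "signs ?\<rho>'" by (rule signs_flip[OF \<rho>(1)])
    have t': "rademacher_point ?\<rho>' = t"
      using rademacher_point_flip[OF \<rho>(1), of n] zero \<rho>(2) by simp
    have zero': "tail ?\<rho>' n = 0"
      using tail_flip[OF \<rho>(1), of n n] zero by simp
    \<comment> \<open>A violation in the flipped sequence would again sit at a zero of the tail,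
      hence at \<open>n\<close>. There the flip has reversed the sign and kept the partial sum, so
      the condition holds.\<close>
    have "step_seq \<alpha> ?\<rho>'"
    proof (rule ccontr)
      assume "\<not> step_seq \<alpha> ?\<rho>'"
      then obtain m where m: "?\<rho>' m * psum \<alpha> ?\<rho>' m > 0"
        using s' by (auto simp: step_seq_def not_le)
      have "m = n"
        by (rule tail_eq_0_unique[OF s' tail_0[OF s' t' m] zero'])
      moreover have "psum \<alpha> ?\<rho>' n = psum \<alpha> \<rho> n"
        by (rule psum_cong) (simp add: flip_def)
      ultimately show False using m n by (simp add: flip_def)
    qed
    then show ?thesis using that t' by blast
  qed
qed

text \<open>Some maximizer exists by compactness and comes from a step sequence; all step sequences
  give the same value.\<close>

lemma step_seq_maximizer:
  assumes "\<alpha> \<in> {-2<..<2}" "step_seq \<alpha> \<rho>"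
  shows "is_maximizer \<alpha> (rademacher_point \<rho>)"
proof -
  obtain t where t: "is_maximizer \<alpha> t"
    using maximizer_exists[OF assms(1)] .
  obtain \<rho>' where "step_seq \<alpha> \<rho>'" "rademacher_point \<rho>' = t"
    using maximizer_step_seq[OF assms(1) t] .
  with step_seq_takagi_eq[OF assms this(1)] t rademacher_point_bounds[OF step_seq_signs[OF assms(2)]]
  show ?thesis by (simp add: is_maximizer_def is_arg_max_def)
qed

section \<open>Flipping and extending step sequences\<close>

lemma psum_flip:
  assumes "n \<le> m"
  shows "psum \<alpha> (flip n \<rho>) m = 2 * psum \<alpha> \<rho> n - psum \<alpha> \<rho> m"
  using assms
proof (induction rule: dec_induct)
  case base
  have "psum \<alpha> (flip n \<rho>) n = psum \<alpha> \<rho> n"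
    by (rule psum_cong) (simp add: flip_def)
  then show ?case by simp
next
  case (step m)
  then show ?case by (simp add: psum_Suc flip_def)
qed

text \<open>From \<open>n\<close> on the partial sums are reflected in
  \<open>psum \<alpha> \<rho> n = 0\<close>, so signs and sums are negated together. The case
  \<open>n = 0\<close> is the global change of sign.\<close>

lemma step_seq_flip:
  assumes "step_seq \<alpha> \<rho>" "psum \<alpha> \<rho> n = 0"
  shows "step_seq \<alpha> (flip n \<rho>)"
  unfolding step_seq_def
proof (intro conjI allI)
  show "signs (flip n \<rho>)" by (rule signs_flip[OF step_seq_signs[OF assms(1)]])
  show "flip n \<rho> m * psum \<alpha> (flip n \<rho>) m \<le> 0" for m
  proof (cases "m < n")
    case True
    then have "psum \<alpha> (flip n \<rho>) m = psum \<alpha> \<rho> m"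
      by (intro psum_cong) (simp add: flip_def)
    with True assms(1) show ?thesis by (simp add: flip_def step_seq_def)
  next
    case False
    with assms show ?thesis by (simp add: flip_def step_seq_def psum_flip)
  qed
qed

text \<open>Each new sign depends on the partial sum of the signs before it. Recursion on the
  partial sums avoids this circularity: the prefix \<open>p\<close> is used below \<open>N\<close>,
  then the sign that opposes the current sum, with 1 chosen when the sum is 0.\<close>

primrec greedy_psum :: "real \<Rightarrow> (nat \<Rightarrow> real) \<Rightarrow> nat \<Rightarrow> nat \<Rightarrow> real" where
  "greedy_psum \<alpha> p N 0 = 0"
| "greedy_psum \<alpha> p N (Suc n) = greedy_psum \<alpha> p N n +
     (if n < N then p n else if greedy_psum \<alpha> p N n \<le> 0 then 1 else - 1) * \<alpha> ^ n"

lemma step_seq_extend: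
  assumes "\<And>n. n < N \<Longrightarrow> p n \<in> {-1, 1}" "\<And>n. n < N \<Longrightarrow> p n * psum \<alpha> p n \<le> 0"
  obtains \<rho> where "step_seq \<alpha> \<rho>" "\<And>n. n < N \<Longrightarrow> \<rho> n = p n"
proof -
  define \<rho> where "\<rho> n = (if n < N then p n else if greedy_psum \<alpha> p N n \<le> 0 then 1 else - 1)" for n
  have q: "psum \<alpha> \<rho> n = greedy_psum \<alpha> p N n" for n
    by (induction n) (simp_all add: psum_Suc \<rho>_def)
  have p: "psum \<alpha> \<rho> n = psum \<alpha> p n" if "n < N" for n
    using that by (intro psum_cong) (simp add: \<rho>_def)
  have "\<rho> n * psum \<alpha> \<rho> n \<le> 0" for n
  proof (cases "n < N")
    case True
    then show ?thesis using assms(2) p by (simp add: \<rho>_def)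
  next
    case False
    then show ?thesis unfolding q by (simp add: \<rho>_def)
  qed
  moreover have "signs \<rho>"
    using assms(1) by (auto simp: signs_def \<rho>_def)
  ultimately show ?thesis
    using that[of \<rho>] by (simp add: step_seq_def \<rho>_def)
qed

subsection \<open>Step roots\<close>

lemma poly_poly_cutoff: "poly (poly_cutoff n P) x = (\<Sum>m<n. coeff P m * x ^ m)"
  for P :: "real poly"
proof -
  have "poly_cutoff n P = (\<Sum>m<n. monom (coeff P m) m)"
    by (rule poly_eqI) (auto simp: coeff_poly_cutoff coeff_sum)
  then show ?thesis by (simp add: poly_sum poly_monom)
qed

lemma step_root_iff:
  "(\<exists>P. littlewood P \<and> step_root P \<alpha>) \<longleftrightarrow> (\<exists>\<rho> n. step_seq \<alpha> \<rho> \<and> \<rho> 0 = 1 \<and> 0 < n \<and> psum \<alpha> \<rho> n = 0)"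
proof
  assume "\<exists>P. littlewood P \<and> step_root P \<alpha>"
  then obtain P where P: "littlewood P" "step_root P \<alpha>" by blast
  define N where "N = Suc (degree P)"
  \<comment> \<open>Multiplying by the constant coefficient makes the first sign 1; the step
    products are unchanged because this factor enters twice.\<close>
  define p where "p n = coeff P 0 * coeff P n" for n
  have c: "coeff P n = -1 \<or> coeff P n = 1" if "n < N" for n
    using P(1) that by (auto simp: littlewood_def N_def)
  have psum_p: "psum \<alpha> p n = coeff P 0 * poly (poly_cutoff n P) \<alpha>" for n
    by (simp add: psum_def p_def poly_poly_cutoff sum_distrib_left mult_ac)
  have "p n * psum \<alpha> p n \<le> 0" if "n < N" for n
  proof (cases n)
    case (Suc k)
    then have "coeff P n * poly (poly_cutoff n P) \<alpha> \<le> 0"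
      using P(2) that by (simp add: step_root_def N_def)
    then show ?thesis
      using c[of 0] psum_p[of n] by (auto simp: p_def N_def)
  qed simp
  moreover have "p n \<in> {-1, 1}" if "n < N" for n
    using c[of 0] c[OF that] by (auto simp: p_def N_def)
  ultimately obtain \<rho> where \<rho>: "step_seq \<alpha> \<rho>" "\<And>n. n < N \<Longrightarrow> \<rho> n = p n"
    using step_seq_extend[of N p \<alpha>] by blast
  have "poly_cutoff N P = P"
    by (rule poly_eqI) (auto simp: coeff_poly_cutoff N_def coeff_eq_0)
  then have "psum \<alpha> p N = 0"
    using psum_p[of N] P(2) by (simp add: step_root_def)
  then have "psum \<alpha> \<rho> N = 0"
    using psum_cong[of N \<rho> p] \<rho>(2) by simp
  moreover have "\<rho> 0 = 1"
    using c[of 0] \<rho>(2)[of 0] by (auto simp: p_def N_def)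
  ultimately show "\<exists>\<rho> n. step_seq \<alpha> \<rho> \<and> \<rho> 0 = 1 \<and> 0 < n \<and> psum \<alpha> \<rho> n = 0"
    using \<rho>(1) N_def by blast
next
  assume "\<exists>\<rho> n. step_seq \<alpha> \<rho> \<and> \<rho> 0 = 1 \<and> 0 < n \<and> psum \<alpha> \<rho> n = 0"
  then obtain \<rho> n where \<rho>: "step_seq \<alpha> \<rho>" "\<rho> 0 = 1" "0 < n" "psum \<alpha> \<rho> n = 0" by blast
  obtain d where n: "n = Suc d" using \<rho>(3) by (cases n) auto
  \<comment> \<open>For \<open>n = 1\<close> the partial sum is the first sign, which is not 0.
    Hence the degree is positive, as \<open>step_root\<close> demands.\<close>
  have "d \<noteq> 0" using \<rho>(2,4) n by (intro notI) (simp add: psum_def)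
  define P where "P = (\<Sum>m<n. monom (\<rho> m) m)"
  have c: "coeff P m = (if m < n then \<rho> m else 0)" for m
    by (auto simp: P_def coeff_sum)
  have "\<rho> m \<noteq> 0" for m
    using signsD[OF step_seq_signs[OF \<rho>(1)], of m] by auto
  then have d: "degree P = d"
    by (intro antisym degree_le le_degree) (auto simp: c n)
  have cut: "poly (poly_cutoff k P) \<alpha> = psum \<alpha> \<rho> k" if "k \<le> n" for k
    using that by (auto simp: poly_poly_cutoff psum_def c intro!: sum.cong)
  have "littlewood P"
    using step_seq_signs[OF \<rho>(1)] by (auto simp: littlewood_def d c n signs_def)
  moreover have "poly P \<alpha> = 0"
    using \<rho>(4) by (simp add: P_def poly_sum poly_monom psum_def)
  then have "step_root P \<alpha>"
    using \<open>d \<noteq> 0\<close> \<rho>(1) by (auto simp: step_root_def d cut c n step_seq_def)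
  ultimately show "\<exists>P. littlewood P \<and> step_root P \<alpha>" by blast
qed

text \<open>If the sum up to \<open>k\<close> equals 1, the bounds for the next two sums give
  \<open>\<alpha> ^ Suc k < 0\<close> and \<open>-1 \<le> \<alpha>\<close>. So \<alpha> is negative
  and \<open>k\<close> is even, and then the sum cannot be positive.\<close>

lemma power_sums_less_1:
  fixes \<alpha> :: real
  assumes "\<And>k. (\<Sum>j=1..k. \<alpha> ^ j) \<le> 1"
  shows "(\<Sum>j=1..k. \<alpha> ^ j) < 1"
proof (rule ccontr)
  assume "\<not> (\<Sum>j=1..k. \<alpha> ^ j) < 1"
  then have k: "(\<Sum>j=1..k. \<alpha> ^ j) = 1"
    using assms[of k] by simp
  then have "\<alpha> \<noteq> 0" by (auto simp: power_0_left)
  have "\<alpha> ^ Suc k \<le> 0"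
    using assms[of "Suc k"] k by simp
  then have neg: "\<alpha> ^ Suc k < 0"
    using \<open>\<alpha> \<noteq> 0\<close> power_not_zero order_le_neq_trans by blast
  have "\<alpha> ^ Suc k * (1 + \<alpha>) \<le> 0"
    using assms[of "Suc (Suc k)"] k by (simp add: algebra_simps)
  then have "-1 \<le> \<alpha>"
    using neg by (simp add: mult_le_0_iff)
  have "\<alpha> < 0" "odd (Suc k)"
    using neg power_less_zero_eq[of \<alpha> "Suc k"] by auto
  then obtain i where i: "k = 2 * i" by (auto elim: evenE)
  \<comment> \<open>Consecutive powers are paired: each pair is
    \<open>\<alpha> ^ (2 * i) * (\<alpha> * (1 + \<alpha>))\<close>, which is at most 0.\<close>
  have "(\<Sum>j=1..2 * i. \<alpha> ^ j) \<le> 0" for i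
  proof (induction i)
    case (Suc i)
    have neg': "\<alpha> * (1 + \<alpha>) \<le> 0"
      using \<open>\<alpha> < 0\<close> \<open>-1 \<le> \<alpha>\<close> by (simp add: mult_le_0_iff)
    have "\<alpha> ^ (2 * i) * (\<alpha> * (1 + \<alpha>)) \<le> 0"
      by (rule mult_nonneg_nonpos[OF _ neg']) simp
    with Suc.IH show ?case by (simp add: algebra_simps)
  qed simp
  with k i show False by (metis not_one_le_zero)
qed

text \<open>A nonzero partial sum forces the next sign to oppose it, so the first sign determines
  all others by induction.\<close>

lemma step_seq_unique:
  assumes "step_seq \<alpha> \<rho>" "step_seq \<alpha> \<rho>'" "\<rho> 0 = \<rho>' 0" "\<And>n. 0 < n \<Longrightarrow> psum \<alpha> \<rho> n \<noteq> 0"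
  shows "\<rho> = \<rho>'"
proof
  fix n
  show "\<rho> n = \<rho>' n"
  proof (induction n rule: less_induct)
    case (less n)
    show ?case
    proof (cases "n = 0")
      case False
      have "psum \<alpha> \<rho> n = psum \<alpha> \<rho>' n"
        using less by (intro psum_cong) auto
      then show ?thesis
        using step_seq_times[OF assms(1), of n] step_seq_times[OF assms(2), of n] False
          assms(4)[of n]
        by (metis mult_cancel_right neq0_conv)
    qed (simp add: assms(3))
  qed
qed

text \<open>A first sign -1 means \<open>t \<ge> 1 / 2\<close>, hence \<open>t = 1 / 2\<close>, and
  flipping all signs gives the other expansion of this point.\<close>

lemma maximizer_step_seq_half:
  assumes "\<alpha> \<in> {-2<..<2}" "is_maximizer \<alpha> t" "t \<le> 1 / 2"
  obtains \<rho> where "step_seq \<alpha> \<rho>" "rademacher_point \<rho> = t" "\<rho> 0 = 1"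
proof -
  obtain \<rho> where \<rho>: "step_seq \<alpha> \<rho>" "rademacher_point \<rho> = t"
    using maximizer_step_seq[OF assms(1,2)] .
  note s = step_seq_signs[OF \<rho>(1)]
  show ?thesis
  proof (cases "\<rho> 0 = 1")
    case True
    then show ?thesis using that \<rho> by blast
  next
    case False
    then have "\<rho> 0 = -1" using signsD[OF s, of 0] by auto
    then have "tail \<rho> 0 = 0"
      using sign_times_tail_nonneg[OF s, of 0] \<rho>(2) assms(3) by (simp add: rademacher_point_def)
    then have "rademacher_point (flip 0 \<rho>) = t"
      using rademacher_point_flip[OF s, of 0] \<rho>(2) by simp
    moreover have "step_seq \<alpha> (flip 0 \<rho>)"
      by (rule step_seq_flip[OF \<rho>(1)]) simp
    ultimately show ?thesis
      using that \<open>\<rho> 0 = -1\<close> by (simp add: flip_def)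
  qed
qed

text \<open>This ensures that flipping at a zero of the partial sums gives a different
  point.\<close>

lemma tail_nonzero_at_psum_zero:
  assumes "step_seq \<alpha> \<rho>" "\<rho> 0 = 1" "0 < N" "psum \<alpha> \<rho> N = 0"
  shows "tail \<rho> N \<noteq> 0"
proof
  assume "tail \<rho> N = 0"
  note s = step_seq_signs[OF assms(1)]
  have const: "\<rho> m = - \<rho> N" if "N < m" for m
    by (rule tail_eq_0[OF s \<open>tail \<rho> N = 0\<close> that])
  \<comment> \<open>Starting again from 0 at \<open>N\<close>, the partial sums are those of 1, -1,
    -1, ... scaled by \<open>\<rho> N * \<alpha> ^ N\<close>. The step condition after
    \<open>N\<close> therefore bounds the sums of powers of \<alpha>.\<close>
  have ps: "psum \<alpha> \<rho> (Suc (N + k)) = \<rho> N * (\<alpha> ^ N * (1 - (\<Sum>j=1..k. \<alpha> ^ j)))" for k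
  proof (induction k)
    case 0
    show ?case using assms(4) by (simp add: psum_Suc)
  next
    case (Suc k)
    then show ?case
      using const[of "Suc (N + k)"] by (simp add: psum_Suc algebra_simps power_add)
  qed
  have ge: "0 \<le> \<alpha> ^ N * (1 - (\<Sum>j=1..k. \<alpha> ^ j))" for k
  proof -
    have "\<rho> (Suc (N + k)) * psum \<alpha> \<rho> (Suc (N + k)) \<le> 0"
      using assms(1) by (simp add: step_seq_def)
    then show ?thesis
      using const[of "Suc (N + k)"] ps[of k] signsD[OF s, of N] by auto
  qed
  have "\<alpha> \<noteq> 0"
  proof
    assume "\<alpha> = 0"
    then have "psum \<alpha> \<rho> (Suc k) = 1" for k
      using assms(2) by (induction k) (simp_all add: psum_Suc)
    with assms(3,4) show False by (metis gr0_implies_Suc zero_neq_one)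
  qed
  \<comment> \<open>For \<open>k = 0\<close> the sum in \<open>ge\<close> is empty, so
    \<open>\<alpha> ^ N\<close> is nonnegative.\<close>
  then have "0 < \<alpha> ^ N"
    using ge[of 0] power_not_zero[of \<alpha> N] by (simp del: power_eq_0_iff)
  have "(\<Sum>j=1..k. \<alpha> ^ j) \<le> 1" for k
    using zero_le_mult_iff[THEN iffD1, OF ge[of k]] \<open>0 < \<alpha> ^ N\<close> by linarith
  then have pos: "(\<Sum>j=1..k. \<alpha> ^ j) < 1" for k
    by (rule power_sums_less_1)
  \<comment> \<open>So the step condition forces \<open>\<rho>\<close> to be \<open>1, -1, -1, \<dots>\<close>, whose partial sums never vanish.\<close>
  have "psum \<alpha> \<rho> (Suc k) = 1 - (\<Sum>j=1..k. \<alpha> ^ j)" for k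
  proof (induction k)
    case 0
    show ?case using assms(2) by (simp add: psum_Suc)
  next
    case (Suc k)
    then have "0 < psum \<alpha> \<rho> (Suc k)" using pos[of k] by simp
    then have "\<rho> (Suc k) = -1"
      using step_seq_times[OF assms(1), of "Suc k"] signsD[OF s, of "Suc k"] by auto
    with Suc show ?case by (simp add: psum_Suc[of _ _ "Suc k"])
  qed
  with pos assms(3,4) show False
    by (metis diff_gt_0_iff_gt gr0_implies_Suc less_irrefl)
qed

theorem corollary4p3:
  fixes \<alpha> :: real
  assumes "\<alpha> \<in> {-2<..<2}"
  shows "(\<exists>!t. t \<in> {0..1/2} \<and> is_maximizer \<alpha> t) \<longleftrightarrow>
         \<not> (\<exists>P. littlewood P \<and> step_root P \<alpha>)"
proof
  assume unique: "\<exists>!t. t \<in> {0..1/2} \<and> is_maximizer \<alpha> t"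
  show "\<not> (\<exists>P. littlewood P \<and> step_root P \<alpha>)"
    unfolding step_root_iff
  proof
    assume "\<exists>\<rho> n. step_seq \<alpha> \<rho> \<and> \<rho> 0 = 1 \<and> 0 < n \<and> psum \<alpha> \<rho> n = 0"
    then obtain \<rho> n where \<rho>: "step_seq \<alpha> \<rho>" "\<rho> 0 = 1" "0 < n" "psum \<alpha> \<rho> n = 0" by blast
    have s: "signs \<rho>" by (rule step_seq_signs[OF \<rho>(1)])
    have max: "rademacher_point \<sigma> \<in> {0..1/2} \<and> is_maximizer \<alpha> (rademacher_point \<sigma>)"
      if "step_seq \<alpha> \<sigma>" "\<sigma> 0 = 1" for \<sigma>
      using rademacher_point_bounds_half[OF step_seq_signs] step_seq_maximizer[OF assms] that by blast
    \<comment> \<open>Since \<open>n > 0\<close>, the flip keeps the first sign, so both points are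
      maximizers in [0, 1/2] and must coincide.\<close>
    have "step_seq \<alpha> (flip n \<rho>)" by (rule step_seq_flip[OF \<rho>(1,4)])
    moreover have "flip n \<rho> 0 = 1" using \<rho>(2,3) by (simp add: flip_def)
    ultimately have "rademacher_point (flip n \<rho>) = rademacher_point \<rho>"
      using unique max \<rho>(1,2) by blast
    then show False
      using rademacher_point_flip[OF s, of n] tail_nonzero_at_psum_zero[OF \<rho>] by simp
  qed
next
  assume "\<not> (\<exists>P. littlewood P \<and> step_root P \<alpha>)"
  then have nz: "psum \<alpha> \<rho> n \<noteq> 0" if "step_seq \<alpha> \<rho>" "\<rho> 0 = 1" "0 < n" for \<rho> n
    using that unfolding step_root_iff by blast
  \<comment> \<open>The one-term prefix 1 satisfies the step condition vacuously and extends to a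
    whole step sequence.\<close>
  obtain \<rho> where \<rho>: "step_seq \<alpha> \<rho>" "\<rho> 0 = 1"
    using step_seq_extend[of 1 "\<lambda>_. 1" \<alpha>] by auto
  show "\<exists>!t. t \<in> {0..1/2} \<and> is_maximizer \<alpha> t"
  proof (rule ex1I)
    show "rademacher_point \<rho> \<in> {0..1/2} \<and> is_maximizer \<alpha> (rademacher_point \<rho>)"
      using rademacher_point_bounds_half[OF step_seq_signs] step_seq_maximizer[OF assms] \<rho> by blast
  next
    fix t
    assume "t \<in> {0..1/2} \<and> is_maximizer \<alpha> t"
    then obtain \<sigma> where "step_seq \<alpha> \<sigma>" "rademacher_point \<sigma> = t" "\<sigma> 0 = 1"
      using maximizer_step_seq_half[OF assms, of t] by auto
    with step_seq_unique[OF \<rho>(1) this(1)] \<rho> nz show "t = rademacher_point \<rho>"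
      by auto
  qed
qed

end
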